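(* Let $(G_n,R^m_n)$ be a sequence in $\mathbf{S}$ with induced poset $\mathbb{P}$, and let $A\subseteq\mathsf{S}\mathbb{P}$. Consider the conditions: (1) $A$ is connected; (2) $[A]_n$ is connected for every $n\in\omega$; (3) $[A]_n^{\sqcap}$ is connected for every $n\in\omega$. Then (1) $\Rightarrow$ (2) $\Rightarrow$ (3). If $(G_n,R^m_n)$ is co-bijective and edge-faithful, $\mathsf{S}\mathbb{P}$ is Hausdorff, and $A$ is closed in $\mathsf{S}\mathbb{P}$, then (1), (2), (3) are equivalent.
   Context: Graphs and relations. A graph is a finite non-empty set $G$ with a reflexive symmetric relation $\sqcap$ (the edge relation). For $D\subseteq G$, $D^{\sqcap}=\{h\in G:\exists g\in D\ (g\sqcap h)\}$. A subset of a graph is connected if it cannot be split into two non-empty parts with no edge between them; the empty set counts as connected, both for graphs and for spaces. A relation $R\subseteq H\times G$ between graphs is viewed as a relation from $G$ to $H$; write $R(g)=\{h:(h,g)\in R\}$; $(c,a)\in Q\circ R$ iff $(c,b)\in Q$ and $(b,a)\in R$ for some $b$. $R$ is: edge-preserving if $(h,g),(h',g')\in R$ and $g\sqcap g'$ imply $h\sqcap h'$; co-surjective if $R(g)\neq\emptyset$ for all $g$; co-bijective if co-surjective and for all $h\in H$ there is $g$ with $R(g)=\{h\}$. $\mathbf{S}$ is the category of graphs with co-surjective edge-preserving relations as morphisms. Sequences. A sequence in $\mathbf{S}$ is a family $(G_n,R^m_n)_{m\le n\in\omega}$ with $R^m_n$ a morphism of $\mathbf{S}$ from $G_n$ to $G_m$,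 $R^n_n$ the identity and $R^l_m\circ R^m_n=R^l_n$ for $l\le m\le n$. It is co-bijective if all $R^m_n$ are. The induced poset is the disjoint union $\mathbb{P}=\bigsqcup_nG_n$, where for $p\in G_n$, $q\in G_m$, $p\le q$ iff $m\le n$ and $(q,p)\in R^m_n$. The sequence is edge-faithful if for all $n$ and $g,h\in G_n$: $g\sqcap h$ iff $g,h$ have a common lower bound in $\mathbb{P}$. Spectrum. In a poset $\mathbb{P}$, a band is a finite $B\subseteq\mathbb{P}$ such that every element of $\mathbb{P}$ is comparable to an element of $B$; a cap is a set $C\subseteq\mathbb P$ for which there is a band $B$ such that each $b\in B$ is $\le$ some $c\in C$; a selector is a subset of $\mathbb{P}$ meeting every cap. The spectrum $\mathsf{S}\mathbb{P}$ is the set of minimal selectors (with respect to inclusion) with the topology generated by the sets $p^\in=\{S\in\mathsf{S}\mathbb{P}:p\in S\}$, $p\in\mathbb{P}$. For $A\subseteq\mathsf{S}\mathbb{P}$ the trace is $[A]_n=\{g\in G_n:g^\in\cap A\ne\emptyset\}$. *)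

theory Defs
  imports "HOL-Analysis.Analysis"
begin

section \<open>Graphs and relations\<close>

definition is_graph :: "'a set \<Rightarrow> 'a rel \<Rightarrow> bool" where
  "is_graph G E \<longleftrightarrow> finite G \<and> G \<noteq> {} \<and> E \<subseteq> G \<times> G \<and> refl_on G E \<and> sym E"

definition neighbourhood :: "'a set \<Rightarrow> 'a rel \<Rightarrow> 'a set \<Rightarrow> 'a set" where
  "neighbourhood G E D = {h \<in> G. \<exists>g\<in>D. (g, h) \<in> E}"

definition graph_connected :: "'a rel \<Rightarrow> 'a set \<Rightarrow> bool" where
  "graph_connected E D \<longleftrightarrow>
    \<not> (\<exists>U V. U \<noteq> {} \<and> V \<noteq> {} \<and> U \<inter> V = {} \<and> U \<union> V = D \<and> (\<forall>u\<in>U. \<forall>v\<in>V. (u, v) \<notin> E))"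

text \<open>A relation \<open>R \<subseteq> H \<times> G\<close> is read from right to left, as a relation from \<open>G\<close> to \<open>H\<close>;
  composition \<open>Q \<circ> R\<close> in this sense is \<open>Q O R\<close>.\<close>

definition rel_at :: "('b \<times> 'a) set \<Rightarrow> 'a \<Rightarrow> 'b set" where
  "rel_at R g = {h. (h, g) \<in> R}"

definition edge_preserving :: "'a rel \<Rightarrow> 'b rel \<Rightarrow> ('b \<times> 'a) set \<Rightarrow> bool" where
  "edge_preserving E F R \<longleftrightarrow>
    (\<forall>h g h' g'. (h, g) \<in> R \<longrightarrow> (h', g') \<in> R \<longrightarrow> (g, g') \<in> E \<longrightarrow> (h, h') \<in> F)"

definition co_surjective :: "'a set \<Rightarrow> ('b \<times> 'a) set \<Rightarrow> bool" where
  "co_surjective G R \<longleftrightarrow> (\<forall>g\<in>G. rel_at R g \<noteq> {})"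

definition co_bijective :: "'a set \<Rightarrow> 'b set \<Rightarrow> ('b \<times> 'a) set \<Rightarrow> bool" where
  "co_bijective G H R \<longleftrightarrow> co_surjective G R \<and> (\<forall>h\<in>H. \<exists>g\<in>G. rel_at R g = {h})"

text \<open>Morphisms from the graph \<open>(G, E)\<close> to the graph \<open>(H, F)\<close> in the category \<open>S\<close>.\<close>

definition S_morphism ::
    "'a set \<Rightarrow> 'a rel \<Rightarrow> 'b set \<Rightarrow> 'b rel \<Rightarrow> ('b \<times> 'a) set \<Rightarrow> bool" where
  "S_morphism G E H F R \<longleftrightarrow> R \<subseteq> H \<times> G \<and> co_surjective G R \<and> edge_preserving E F R"


section \<open>Sequences and their induced posets\<close>

text \<open>\<open>R m n\<close> is the morphism from \<open>G n\<close> to \<open>G m\<close>; its values for \<open>m > n\<close> play no role.\<close>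

definition S_sequence ::
    "(nat \<Rightarrow> 'a set) \<Rightarrow> (nat \<Rightarrow> 'a rel) \<Rightarrow> (nat \<Rightarrow> nat \<Rightarrow> 'a rel) \<Rightarrow> bool" where
  "S_sequence G E R \<longleftrightarrow>
    (\<forall>n. is_graph (G n) (E n)) \<and>
    (\<forall>m n. m \<le> n \<longrightarrow> S_morphism (G n) (E n) (G m) (E m) (R m n)) \<and>
    (\<forall>n. R n n = Id_on (G n)) \<and>
    (\<forall>l m n. l \<le> m \<longrightarrow> m \<le> n \<longrightarrow> R l m O R m n = R l n)"

definition co_bijective_sequence ::
    "(nat \<Rightarrow> 'a set) \<Rightarrow> (nat \<Rightarrow> nat \<Rightarrow> 'a rel) \<Rightarrow> bool" where
  "co_bijective_sequence G R \<longleftrightarrow> (\<forall>m n. m \<le> n \<longrightarrow> co_bijective (G n) (G m) (R m n))"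

definition induced_carrier :: "(nat \<Rightarrow> 'a set) \<Rightarrow> (nat \<times> 'a) set" where
  "induced_carrier G = Sigma UNIV G"

definition induced_le :: "(nat \<Rightarrow> nat \<Rightarrow> 'a rel) \<Rightarrow> nat \<times> 'a \<Rightarrow> nat \<times> 'a \<Rightarrow> bool" where
  "induced_le R p q \<longleftrightarrow> fst q \<le> fst p \<and> (snd q, snd p) \<in> R (fst q) (fst p)"

definition edge_faithful ::
    "(nat \<Rightarrow> 'a set) \<Rightarrow> (nat \<Rightarrow> 'a rel) \<Rightarrow> (nat \<Rightarrow> nat \<Rightarrow> 'a rel) \<Rightarrow> bool" where
  "edge_faithful G E R \<longleftrightarrow>
    (\<forall>n. \<forall>g\<in>G n. \<forall>h\<in>G n. (g, h) \<in> E n \<longleftrightarrow>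
      (\<exists>r\<in>induced_carrier G. induced_le R r (n, g) \<and> induced_le R r (n, h)))"


section \<open>The spectrum of a poset with carrier \<open>P\<close> and order \<open>le\<close>\<close>

definition band :: "'p set \<Rightarrow> ('p \<Rightarrow> 'p \<Rightarrow> bool) \<Rightarrow> 'p set \<Rightarrow> bool" where
  "band P le B \<longleftrightarrow> finite B \<and> B \<subseteq> P \<and> (\<forall>p\<in>P. \<exists>b\<in>B. le p b \<or> le b p)"

definition cap :: "'p set \<Rightarrow> ('p \<Rightarrow> 'p \<Rightarrow> bool) \<Rightarrow> 'p set \<Rightarrow> bool" where
  "cap P le C \<longleftrightarrow> C \<subseteq> P \<and> (\<exists>B. band P le B \<and> (\<forall>b\<in>B. \<exists>c\<in>C. le b c))"

definition selector :: "'p set \<Rightarrow> ('p \<Rightarrow> 'p \<Rightarrow> bool) \<Rightarrow> 'p set \<Rightarrow> bool" where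
  "selector P le S \<longleftrightarrow> S \<subseteq> P \<and> (\<forall>C. cap P le C \<longrightarrow> S \<inter> C \<noteq> {})"

definition spectrum :: "'p set \<Rightarrow> ('p \<Rightarrow> 'p \<Rightarrow> bool) \<Rightarrow> 'p set set" where
  "spectrum P le = {S. selector P le S \<and> (\<forall>T. selector P le T \<longrightarrow> T \<subseteq> S \<longrightarrow> T = S)}"

definition spec_in :: "'p set \<Rightarrow> ('p \<Rightarrow> 'p \<Rightarrow> bool) \<Rightarrow> 'p \<Rightarrow> 'p set set" where
  "spec_in P le p = {S \<in> spectrum P le. p \<in> S}"

text \<open>The whole spectrum, as the empty intersection of subbasic sets, is added explicitly because
  \<^const>\<open>topology_generated_by\<close> takes the union of the given sets as underlying space.\<close>

definition spectrum_topology :: "'p set \<Rightarrow> ('p \<Rightarrow> 'p \<Rightarrow> bool) \<Rightarrow> 'p set topology" where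
  "spectrum_topology P le = topology_generated_by (insert (spectrum P le) (spec_in P le ` P))"

lemma topspace_spectrum_topology [simp]: "topspace (spectrum_topology P le) = spectrum P le"
  by (auto simp: spectrum_topology_def spec_in_def)

definition spec_trace ::
    "(nat \<Rightarrow> 'a set) \<Rightarrow> (nat \<Rightarrow> nat \<Rightarrow> 'a rel) \<Rightarrow> (nat \<times> 'a) set set \<Rightarrow> nat \<Rightarrow> 'a set" where
  "spec_trace G R A n =
    {g \<in> G n. spec_in (induced_carrier G) (induced_le R) (n, g) \<inter> A \<noteq> {}}"

end

theory Submission
  imports Defs
begin

text \<open>
  The complement of a set \<open>S\<close> fails to be a cap exactly if \<open>S\<close> is a selector, so by Zorn's lemma a set
  meeting all points of the spectrum is a cap. Level \<open>n\<close> together with the atoms above it is a band,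
  and these bands refine all caps. Hence points of the spectrum are down-directed, so two elements of
  the same level in one point are adjacent, and a separation of \<open>[A]\<^sub>n\<close> yields one of \<open>A\<close>.

  For the converse, levels themselves are bands, and every open cover of the spectrum is refined by
  the sets \<open>g\<^sup>\<in>\<close> with \<open>g \<in> G\<^sub>n\<close> for some \<open>n\<close>. If a closed \<open>A\<close> splits into closed parts \<open>B\<close> and \<open>C\<close>, take a
  Urysohn function \<open>f\<close> separating them and \<open>n\<close> such that \<open>f\<close> oscillates by less than 1/4 on each \<open>g\<^sup>\<in>\<close>.
  Adjacent elements of a co-bijective edge-faithful sequence share a point, so an edge between the
  neighbourhoods of \<open>[B]\<^sub>n\<close> and \<open>[C]\<^sub>n\<close> would give a chain of four elements along which \<open>f\<close> varies by
  less than 1.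
\<close>

section \<open>Caps and minimal selectors\<close>

lemma cap_mono: "cap P le C \<Longrightarrow> C \<subseteq> D \<Longrightarrow> D \<subseteq> P \<Longrightarrow> cap P le D"
  unfolding cap_def by blast

text \<open>Caps are stable under enlargement inside \<open>P\<close>, so a cap disjoint from
  \<open>S\<close> would make all of \<open>P - S\<close> a cap.\<close>

lemma selector_iff_complement_not_cap:
  assumes "S \<subseteq> P"
  shows "selector P le S \<longleftrightarrow> \<not> cap P le (P - S)"
proof
  assume "selector P le S"
  then show "\<not> cap P le (P - S)"
    unfolding selector_def by blast
next
  assume nc: "\<not> cap P le (P - S)"
  have "S \<inter> C \<noteq> {}" if C: "cap P le C" for C
  proof
    assume "S \<inter> C = {}"
    moreover have "C \<subseteq> P" using C by (simp add: cap_def)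
    ultimately have "C \<subseteq> P - S" by blast
    with C nc show False by (meson Diff_subset cap_mono)
  qed
  with assms show "selector P le S" by (simp add: selector_def)
qed

text \<open>One upper bound for each element of the finite band suffices. This is the finiteness
  that Zorn's lemma needs below.\<close>

lemma cap_finite_subcap:
  assumes "cap P le C"
  obtains D where "D \<subseteq> C" "finite D" "cap P le D"
proof -
  from assms obtain B where B: "band P le B" "\<forall>b\<in>B. \<exists>c\<in>C. le b c" and C: "C \<subseteq> P"
    by (auto simp: cap_def)
  from B(2) obtain f where f: "\<forall>b\<in>B. f b \<in> C \<and> le b (f b)" by metis
  show thesis
  proof (rule that)
    show "f ` B \<subseteq> C" using f by blast
    show "finite (f ` B)" using B(1) by (simp add: band_def)
    show "cap P le (f ` B)" unfolding cap_def using B(1) C f by blast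
  qed
qed

text \<open>Zorn's lemma is applied to complements: minimal selectors are the complements of maximal
  non-caps. A union of a chain of non-caps is a non-cap, since a finite subcap would already lie in
  one member of the chain.\<close>

lemma selector_contains_minimal:
  assumes S: "selector P le S"
  obtains T where "T \<in> spectrum P le" "T \<subseteq> S"
proof -
  define F where "F = {M. P - S \<subseteq> M \<and> M \<subseteq> P \<and> \<not> cap P le M}"
  have SP: "S \<subseteq> P" using S by (simp add: selector_def)
  have "\<exists>M\<in>F. \<forall>X\<in>F. M \<subseteq> X \<longrightarrow> X = M"
  proof (rule subset_Zorn_nonempty)
    have "P - S \<in> F"
      using S SP selector_iff_complement_not_cap unfolding F_def by auto
    then show "F \<noteq> {}" by blast
  next
    fix K assume K: "K \<noteq> {}" "subset.chain F K"
    have KF: "K \<subseteq> F" using K(2) by (simp add: subset_chain_def)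
    have "\<not> cap P le (\<Union>K)"
    proof
      assume "cap P le (\<Union>K)"
      then obtain D where D: "D \<subseteq> \<Union>K" "finite D" "cap P le D"
        by (rule cap_finite_subcap)
      then obtain M where "M \<in> K" "D \<subseteq> M"
        using finite_subset_Union_chain[OF D(2,1) K(1,2)] by blast
      moreover from this KF have "M \<subseteq> P" "\<not> cap P le M" by (auto simp: F_def)
      ultimately show False using D(3) cap_mono by blast
    qed
    with K(1) KF show "\<Union>K \<in> F" unfolding F_def by blast
  qed
  then obtain M where M: "M \<in> F" and max: "\<And>X. X \<in> F \<Longrightarrow> M \<subseteq> X \<Longrightarrow> X = M" by blast
  have MP: "M \<subseteq> P" "P - S \<subseteq> M" "\<not> cap P le M" using M by (auto simp: F_def)
  have PPM: "P - (P - M) = M" using MP(1) by blast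
  show thesis
  proof (rule that)
    show "P - M \<subseteq> S" using MP(2) by blast
    have "T = P - M" if T: "selector P le T" "T \<subseteq> P - M" for T
    proof -
      have "\<not> cap P le (P - T)" using T selector_iff_complement_not_cap[of T P le] by auto
      then have "P - T = M" using T(2) MP(1,2) by (intro max) (auto simp: F_def)
      then show ?thesis using T(2) by blast
    qed
    moreover have "selector P le (P - M)"
      using MP(3) PPM selector_iff_complement_not_cap[of "P - M" P le] by auto
    ultimately show "P - M \<in> spectrum P le" by (simp add: spectrum_def)
  qed
qed

text \<open>Otherwise the complement of \<open>C\<close> is a selector, and a minimal selector
  inside it misses \<open>C\<close>. This later turns covers of the spectrum into caps.\<close>

lemma cap_if_meets_spectrum:
  assumes "C \<subseteq> P" and "\<And>S. S \<in> spectrum P le \<Longrightarrow> S \<inter> C \<noteq> {}"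
  shows "cap P le C"
proof (rule ccontr)
  assume "\<not> cap P le C"
  moreover have "P - (P - C) = C" using assms(1) by blast
  ultimately have "selector P le (P - C)"
    using selector_iff_complement_not_cap[of "P - C" P le] by auto
  then obtain T where "T \<in> spectrum P le" "T \<subseteq> P - C" by (rule selector_contains_minimal)
  with assms(2) show False by blast
qed

lemma spectrum_subset_carrier: "S \<in> spectrum P le \<Longrightarrow> S \<subseteq> P"
  by (simp add: spectrum_def selector_def)

lemma spectrum_meets_cap: "S \<in> spectrum P le \<Longrightarrow> cap P le C \<Longrightarrow> S \<inter> C \<noteq> {}"
  by (simp add: spectrum_def selector_def)

text \<open>By minimality \<open>S - {p}\<close> is no selector, so it misses some cap, which
  \<open>S\<close> can then meet only in \<open>p\<close>.\<close>

lemma spectrum_witness_cap: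
  assumes S: "S \<in> spectrum P le" and p: "p \<in> S"
  obtains C where "cap P le C" "S \<inter> C = {p}"
proof -
  have "\<not> selector P le (S - {p})" using S p unfolding spectrum_def by blast
  moreover have "S - {p} \<subseteq> P" using spectrum_subset_carrier[OF S] by blast
  ultimately obtain C where C: "cap P le C" "(S - {p}) \<inter> C = {}"
    by (auto simp: selector_def)
  moreover have "S \<inter> C \<noteq> {}" using spectrum_meets_cap[OF S C(1)] .
  ultimately have "S \<inter> C = {p}" by blast
  with C(1) show thesis by (rule that)
qed

text \<open>Replacing \<open>p\<close> by \<open>q\<close> in a cap that \<open>S\<close> meets only
  in \<open>p\<close> leaves a cap, and \<open>S\<close> can meet the new one only in
  \<open>q\<close>.\<close>

lemma spectrum_up_closed:
  assumes trans: "\<And>p q r. le p q \<Longrightarrow> le q r \<Longrightarrow> le p r"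
    and S: "S \<in> spectrum P le" and p: "p \<in> S" "le p q" and q: "q \<in> P"
  shows "q \<in> S"
proof -
  obtain C where C: "cap P le C" "S \<inter> C = {p}" using spectrum_witness_cap[OF S p(1)] .
  obtain B where B: "band P le B" "\<forall>b\<in>B. \<exists>c\<in>C. le b c" and CP: "C \<subseteq> P"
    using C(1) by (auto simp: cap_def)
  have "\<exists>c\<in>insert q (C - {p}). le b c" if "b \<in> B" for b
    using B(2) that trans p(2) by (metis Diff_iff insert_iff singletonD)
  then have "cap P le (insert q (C - {p}))"
    using B(1) CP q unfolding cap_def by blast
  from spectrum_meets_cap[OF S this] show ?thesis using C(2) by blast
qed

text \<open>The complement of \<open>B - {p}\<close> is a selector. A minimal selector inside it
  still meets the cap \<open>B\<close>, necessarily in \<open>p\<close>.\<close>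

lemma spec_in_nonempty_if_not_cap:
  assumes "B \<subseteq> P" "cap P le B" "\<not> cap P le (B - {p})"
  shows "spec_in P le p \<noteq> {}"
proof -
  have "P - (P - (B - {p})) = B - {p}" using assms(1) by blast
  then have "selector P le (P - (B - {p}))"
    using assms(3) selector_iff_complement_not_cap[of "P - (B - {p})" P le] by auto
  then obtain T where T: "T \<in> spectrum P le" "T \<subseteq> P - (B - {p})"
    by (rule selector_contains_minimal)
  moreover have "T \<inter> B \<noteq> {}" using spectrum_meets_cap[OF T(1) assms(2)] .
  ultimately have "p \<in> T" by blast
  with T(1) show ?thesis by (auto simp: spec_in_def)
qed

lemma openin_spec_in:
  "p \<in> P \<Longrightarrow> openin (spectrum_topology P le) (spec_in P le p)"
  unfolding spectrum_topology_def by (rule topology_generated_by_Basis) blast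

section \<open>Connected subsets of graphs\<close>

lemma graph_connectedD:
  assumes "graph_connected E D" "U \<noteq> {}" "V \<noteq> {}" "U \<inter> V = {}" "U \<union> V = D"
  obtains u v where "u \<in> U" "v \<in> V" "(u, v) \<in> E"
  using assms unfolding graph_connected_def by blast

text \<open>Every vertex of the neighbourhood is adjacent to one of \<open>D\<close>, so both sides
  of a separation meet \<open>D\<close> and the separation restricts to \<open>D\<close>.\<close>

lemma graph_connected_neighbourhood:
  assumes gr: "is_graph G E" and D: "D \<subseteq> G" "graph_connected E D"
  shows "graph_connected E (neighbourhood G E D)"
  unfolding graph_connected_def
proof (rule notI, elim exE conjE)
  fix U V assume UV: "U \<noteq> {}" "V \<noteq> {}" "U \<inter> V = {}" "U \<union> V = neighbourhood G E D"
    and no: "\<forall>u\<in>U. \<forall>v\<in>V. (u, v) \<notin> E"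
  have symE: "sym E" and refl: "\<And>g. g \<in> G \<Longrightarrow> (g, g) \<in> E"
    using gr by (auto simp: is_graph_def refl_on_def)
  have DN: "D \<subseteq> U \<union> V" using D(1) refl UV(4) by (auto simp: neighbourhood_def)
  have "U \<inter> D \<noteq> {}"
  proof
    assume e: "U \<inter> D = {}"
    obtain u where u: "u \<in> U" using UV(1) by blast
    then have "u \<in> neighbourhood G E D" using UV(4) by blast
    then obtain d where d: "d \<in> D" "(d, u) \<in> E" by (auto simp: neighbourhood_def)
    then have "d \<in> V" "(u, d) \<in> E" using DN e symE by (auto dest: symD)
    with no u show False by blast
  qed
  moreover have "V \<inter> D \<noteq> {}"
  proof
    assume e: "V \<inter> D = {}"
    obtain v where v: "v \<in> V" using UV(2) by blast
    then have "v \<in> neighbourhood G E D" using UV(4) by blast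
    then obtain d where d: "d \<in> D" "(d, v) \<in> E" by (auto simp: neighbourhood_def)
    then have "d \<in> U" using DN e by auto
    with no v d show False by blast
  qed
  moreover have "(U \<inter> D) \<inter> (V \<inter> D) = {}" "(U \<inter> D) \<union> (V \<inter> D) = D" using UV(3) DN by blast+
  ultimately show False using graph_connectedD[OF D(2)] no by (metis IntD1)
qed

section \<open>The spectrum of a sequence\<close>

locale graph_sequence =
  fixes G :: "nat \<Rightarrow> 'a set" and E :: "nat \<Rightarrow> 'a rel" and R :: "nat \<Rightarrow> nat \<Rightarrow> 'a rel"
  assumes seq: "S_sequence G E R"
begin

abbreviation P where "P \<equiv> induced_carrier G"
abbreviation le where "le \<equiv> induced_le R"
abbreviation X where "X \<equiv> spectrum_topology P le"

section \<open>The order of the induced poset and its levels\<close>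

lemma graph: "is_graph (G n) (E n)"
  using seq by (simp add: S_sequence_def)

lemma morphism: "m \<le> n \<Longrightarrow> S_morphism (G n) (E n) (G m) (E m) (R m n)"
  using seq by (simp add: S_sequence_def)

lemma rel_id: "R n n = Id_on (G n)"
  using seq by (simp add: S_sequence_def)

lemma rel_comp: "l \<le> m \<Longrightarrow> m \<le> n \<Longrightarrow> R l m O R m n = R l n"
  using seq by (simp add: S_sequence_def)

lemma edge_refl: "g \<in> G n \<Longrightarrow> (g, g) \<in> E n"
  using graph[of n] by (auto simp: is_graph_def refl_on_def)

lemma level_mem [simp]: "(n, g) \<in> P \<longleftrightarrow> g \<in> G n"
  by (simp add: induced_carrier_def)

lemma le_carrier:
  assumes "le p q"
  shows "p \<in> P" "q \<in> P"
proof -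
  have "R (fst q) (fst p) \<subseteq> G (fst q) \<times> G (fst p)"
    using assms morphism by (auto simp: induced_le_def S_morphism_def)
  then show "p \<in> P" "q \<in> P"
    using assms unfolding induced_le_def induced_carrier_def
    by (cases p; cases q; auto)+
qed

lemma le_refl: "p \<in> P \<Longrightarrow> le p p"
  by (auto simp: induced_le_def induced_carrier_def rel_id)

lemma le_trans: "le p q \<Longrightarrow> le q r \<Longrightarrow> le p r"
  using rel_comp[of "fst r" "fst q" "fst p"] by (auto simp: induced_le_def)

lemma le_level: "le p q \<Longrightarrow> fst q \<le> fst p"
  by (simp add: induced_le_def)

lemma le_same_level: "le p q \<Longrightarrow> fst p = fst q \<Longrightarrow> p = q"
  by (auto simp: induced_le_def rel_id prod_eq_iff)

text \<open>The composition law factors the relation between the two levels through level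
  \<open>n\<close>.\<close>

lemma le_interpolate:
  assumes "le p q" "fst q \<le> n" "n \<le> fst p"
  obtains g where "g \<in> G n" "le p (n, g)" "le (n, g) q"
proof -
  have "(snd q, snd p) \<in> R (fst q) n O R n (fst p)"
    using assms by (simp add: rel_comp induced_le_def)
  then obtain g where "(snd q, g) \<in> R (fst q) n" "(g, snd p) \<in> R n (fst p)" by blast
  then have "le p (n, g)" "le (n, g) q" using assms by (auto simp: induced_le_def)
  moreover from this have "g \<in> G n" using le_carrier(2) level_mem by blast
  ultimately show thesis using that by blast
qed

lemma le_level_exists:
  assumes "p \<in> P" "n \<le> fst p"
  obtains g where "g \<in> G n" "le p (n, g)"
proof -
  have "snd p \<in> G (fst p)" using assms(1) by (auto simp: induced_carrier_def)
  then obtain g where "(g, snd p) \<in> R n (fst p)"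
    using morphism[OF assms(2)] by (auto simp: S_morphism_def co_surjective_def rel_at_def)
  then have "le p (n, g)" using assms(2) by (simp add: induced_le_def)
  moreover from this have "g \<in> G n" using le_carrier(2) level_mem by blast
  ultimately show thesis using that by blast
qed

text \<open>Edge preservation is applied to the loop at \<open>w\<close>.\<close>

lemma common_lower_bound_edge:
  assumes "le w (n, g)" "le w (n, h)"
  shows "(g, h) \<in> E n"
proof -
  have "n \<le> fst w" using le_level[OF assms(1)] by simp
  moreover have "snd w \<in> G (fst w)" using le_carrier(1)[OF assms(1)]
    by (auto simp: induced_carrier_def)
  ultimately show ?thesis
    using morphism[of n "fst w"] edge_refl[of "snd w" "fst w"] assms
    unfolding S_morphism_def edge_preserving_def induced_le_def by auto
qed

section \<open>Level bands\<close>

definition atom :: "nat \<times> 'a \<Rightarrow> bool" where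
  "atom q \<longleftrightarrow> q \<in> P \<and> (\<forall>p. le p q \<longrightarrow> p = q)"

text \<open>The relations need not be surjective, so a level need not be a band; the atoms above it
  have to be added.\<close>

definition level_band :: "nat \<Rightarrow> (nat \<times> 'a) set" where
  "level_band n = {n} \<times> G n \<union> {q. atom q \<and> fst q < n}"

lemma level_band_subset: "level_band n \<subseteq> P"
  by (auto simp: level_band_def atom_def)

text \<open>Below a non-atom there is an element of a strictly higher level. Descending from
  \<open>p\<close> therefore ends in an atom, reaches level \<open>n\<close>, or jumps past level
  \<open>n\<close>, where interpolation supplies an element. The induction is on the number of
  levels left.\<close>

lemma level_band_below:
  "p \<in> P \<Longrightarrow> fst p \<le> n \<Longrightarrow> \<exists>b\<in>level_band n. le b p"
proof (induction "n - fst p" arbitrary: p rule: less_induct)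
  case less
  show ?case
  proof (cases "p \<in> level_band n")
    case True
    then show ?thesis using le_refl less.prems(1) by blast
  next
    case False
    moreover have "p \<in> {fst p} \<times> G (fst p)" using less.prems(1) by (auto simp: induced_carrier_def)
    ultimately have "fst p \<noteq> n" by (auto simp: level_band_def)
    then have lt: "fst p < n" using less.prems(2) by simp
    then have "\<not> atom p" using False by (simp add: level_band_def)
    then obtain p' where p': "le p' p" "p' \<noteq> p" using less.prems(1) unfolding atom_def by blast
    have gt: "fst p < fst p'" using le_level[OF p'(1)] le_same_level[OF p'(1)] p'(2) by linarith
    show ?thesis
    proof (cases "fst p' \<le> n")
      case True
      have "n - fst p' < n - fst p" using gt lt by linarith
      with less.hyps[of p'] le_carrier(1)[OF p'(1)] True le_trans p'(1) show ?thesis by blast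
    next
      case False
      then obtain g where "g \<in> G n" "le (n, g) p"
        using le_interpolate[OF p'(1), of n] less.prems(2) by auto
      then show ?thesis unfolding level_band_def by blast
    qed
  qed
qed

lemma band_level_band: "band P le (level_band n)"
  unfolding band_def
proof (intro conjI ballI)
  have "level_band n \<subseteq> Sigma {..n} G"
    by (auto simp: level_band_def atom_def induced_carrier_def)
  moreover have "finite (Sigma {..n} G)"
    using graph by (auto simp: is_graph_def)
  ultimately show "finite (level_band n)" by (rule finite_subset)
  show "level_band n \<subseteq> P" by (rule level_band_subset)
  fix p assume p: "p \<in> P"
  show "\<exists>b\<in>level_band n. le p b \<or> le b p"
  proof (cases "fst p \<le> n")
    case True
    then show ?thesis using level_band_below[OF p] by blast
  next
    case False
    then obtain g where "g \<in> G n" "le p (n, g)" using le_level_exists[OF p, of n] by auto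
    then show ?thesis unfolding level_band_def by blast
  qed
qed

lemma cap_level_band: "cap P le (level_band n)"
  unfolding cap_def using level_band_subset band_level_band le_refl by blast

text \<open>Let \<open>n\<close> exceed all levels of a finite band \<open>D\<close> that refines
  \<open>C\<close>. If some \<open>d\<close> in \<open>D\<close> is below an element
  \<open>b\<close> of the level band, then \<open>b\<close> has level less than \<open>n\<close>,
  hence is an atom and equals \<open>d\<close>. So every \<open>b\<close> is below an element of
  \<open>D\<close>.\<close>

lemma level_band_refines_cap:
  assumes "cap P le C"
  shows "\<exists>N. \<forall>n\<ge>N. \<forall>b\<in>level_band n. \<exists>c\<in>C. le b c"
proof -
  obtain D where D: "band P le D" "\<forall>b\<in>D. \<exists>c\<in>C. le b c" using assms by (auto simp: cap_def)
  then have "finite (fst ` D)" by (simp add: band_def)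
  then obtain N where N: "\<And>d. d \<in> D \<Longrightarrow> fst d < N"
    by (auto simp: finite_nat_set_iff_bounded)
  have "\<exists>c\<in>C. le b c" if n: "N \<le> n" and b: "b \<in> level_band n" for n b
  proof -
    have "b \<in> P" using b level_band_subset by blast
    then obtain d where d: "d \<in> D" "le b d \<or> le d b" using D(1) by (auto simp: band_def)
    have "le b d"
    proof (cases "le b d")
      case False
      then have db: "le d b" using d(2) by blast
      then have "fst b < n" using le_level N[OF d(1)] n by fastforce
      then have "atom b" using b by (auto simp: level_band_def)
      then have "d = b" using db unfolding atom_def by blast
      then show ?thesis using db by simp
    qed
    then show ?thesis using D(2) d(1) le_trans by blast
  qed
  then show ?thesis by blast
qed

section \<open>Points of the spectrum as filters\<close>

lemma up_closed: "S \<in> spectrum P le \<Longrightarrow> p \<in> S \<Longrightarrow> le p q \<Longrightarrow> q \<in> S"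
  by (rule spectrum_up_closed[where le = le, OF le_trans]) (auto dest: le_carrier(2))

lemma spec_in_mono: "le p q \<Longrightarrow> spec_in P le p \<subseteq> spec_in P le q"
  unfolding spec_in_def using up_closed by blast

text \<open>A level band refining the two caps that single out \<open>p\<close> and \<open>q\<close>
  meets \<open>S\<close> in some \<open>w\<close>. The elements of these caps above \<open>w\<close>
  lie in \<open>S\<close> by up-closure, so they are \<open>p\<close> and \<open>q\<close>.\<close>

lemma spectrum_directed:
  assumes S: "S \<in> spectrum P le" and pq: "p \<in> S" "q \<in> S"
  obtains w where "w \<in> S" "le w p" "le w q"
proof -
  obtain C where C: "cap P le C" "S \<inter> C = {p}" using spectrum_witness_cap[OF S pq(1)] .
  obtain D where D: "cap P le D" "S \<inter> D = {q}" using spectrum_witness_cap[OF S pq(2)] .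
  obtain M where M: "\<And>n b. M \<le> n \<Longrightarrow> b \<in> level_band n \<Longrightarrow> \<exists>c\<in>C. le b c"
    using level_band_refines_cap[OF C(1)] by blast
  obtain N where N: "\<And>n b. N \<le> n \<Longrightarrow> b \<in> level_band n \<Longrightarrow> \<exists>c\<in>D. le b c"
    using level_band_refines_cap[OF D(1)] by blast
  obtain w where w: "w \<in> S" "w \<in> level_band (max M N)"
    using spectrum_meets_cap[OF S cap_level_band] by blast
  obtain c d where cd: "c \<in> C" "le w c" "d \<in> D" "le w d"
    using M[OF _ w(2)] N[OF _ w(2)] by auto
  then have "c = p" "d = q" using up_closed[OF S w(1)] C(2) D(2) by blast+
  with cd w(1) show thesis using that by blast
qed

lemma spectrum_level_edge:
  assumes "S \<in> spectrum P le" "(n, g) \<in> S" "(n, h) \<in> S"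
  shows "(g, h) \<in> E n"
  using spectrum_directed[OF assms] common_lower_bound_edge by blast

section \<open>Atoms and traces of connected sets\<close>

text \<open>An atom belongs to the level bands of all higher levels, and these eventually refine any
  given cap.\<close>

lemma atom_up_set_selector:
  assumes "atom q"
  shows "selector P le {p \<in> P. le q p}"
  unfolding selector_def
proof (intro conjI allI impI)
  fix C assume C: "cap P le C"
  obtain N where N: "\<And>n b. N \<le> n \<Longrightarrow> b \<in> level_band n \<Longrightarrow> \<exists>c\<in>C. le b c"
    using level_band_refines_cap[OF C] by blast
  have "q \<in> level_band (Suc (max N (fst q)))" using assms by (auto simp: level_band_def)
  then obtain c where "c \<in> C" "le q c" using N[of "Suc (max N (fst q))"]
    by (meson le_SucI max.cobounded1)
  then show "{p \<in> P. le q p} \<inter> C \<noteq> {}" using le_carrier(2) by blast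
qed auto

text \<open>The up-set of \<open>q\<close> is a selector contained in \<open>S\<close>, so
  minimality gives equality. An atom thus determines at most one point, which is isolated.\<close>

lemma atom_spec_in:
  assumes "atom q" "S \<in> spec_in P le q"
  shows "S = {p \<in> P. le q p}"
proof -
  have S: "S \<in> spectrum P le" "q \<in> S" using assms(2) by (auto simp: spec_in_def)
  have "{p \<in> P. le q p} \<subseteq> S" using up_closed[OF S] by blast
  with S(1) atom_up_set_selector[OF assms(1)] show ?thesis by (auto simp: spectrum_def)
qed

lemma spectrum_meets_level_or_atom:
  assumes "S \<in> spectrum P le"
  obtains (level) g where "g \<in> G n" "(n, g) \<in> S" | (atom) q where "atom q" "q \<in> S"
  using spectrum_meets_cap[OF assms cap_level_band[of n]] by (auto simp: level_band_def)

text \<open>A separation of the trace yields open sets \<open>O1\<close> and \<open>O2\<close> that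
  separate \<open>A\<close>. A common point would contain elements of \<open>U\<close> and of
  \<open>V\<close>, which would then be adjacent.\<close>

lemma connected_trace:
  assumes A: "A \<subseteq> spectrum P le" and con: "connectedin X A"
  shows "graph_connected (E n) (spec_trace G R A n)"
  unfolding graph_connected_def
proof (rule notI, elim exE conjE)
  fix U V assume UV: "U \<noteq> {}" "V \<noteq> {}" "U \<inter> V = {}" "U \<union> V = spec_trace G R A n"
    and no: "\<forall>u\<in>U. \<forall>v\<in>V. (u, v) \<notin> E n"
  have UVG: "U \<subseteq> G n" "V \<subseteq> G n" using UV(4) by (auto simp: spec_trace_def)
  define O1 where "O1 = (\<Union>u\<in>U. spec_in P le (n, u))"
  text \<open>A point of \<open>A\<close> that misses level \<open>n\<close> contains an atom and hence is isolated, so it may be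
    put on either side of the separation.\<close>
  define O2 where "O2 = (\<Union>v\<in>V. spec_in P le (n, v)) \<union>
    \<Union>{spec_in P le q |q. atom q \<and> spec_in P le q \<inter> O1 = {}}"
  have "openin X O1" unfolding O1_def using UVG
    by (intro openin_Union) (auto intro!: openin_spec_in)
  moreover have "openin X O2" unfolding O2_def using UVG
    by (intro openin_Un openin_Union) (auto intro!: openin_spec_in simp: atom_def)
  moreover have "A \<subseteq> O1 \<union> O2"
  proof
    fix S assume SA: "S \<in> A"
    then have S: "S \<in> spectrum P le" using A by blast
    show "S \<in> O1 \<union> O2"
    proof (rule ccontr)
      assume nin: "S \<notin> O1 \<union> O2"
      from S show False
      proof (cases rule: spectrum_meets_level_or_atom[where n = n])
        case (level g)
        then have "g \<in> spec_trace G R A n" using S SA by (auto simp: spec_trace_def spec_in_def)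
        then have "g \<in> U \<union> V" using UV(4) by simp
        then show False using nin level(2) S by (auto simp: O1_def O2_def spec_in_def)
      next
        case (atom q)
        have Sq: "S \<in> spec_in P le q" using S atom(2) by (simp add: spec_in_def)
        then have "spec_in P le q = {S}" using atom_spec_in[OF atom(1)] by blast
        then have "spec_in P le q \<inter> O1 = {}" using nin by simp
        then show False using nin Sq atom(1) unfolding O2_def by blast
      qed
    qed
  qed
  moreover have "O1 \<inter> O2 \<inter> A = {}"
  proof -
    have "S \<notin> O2" if S: "S \<in> O1" for S
    proof
      assume "S \<in> O2"
      then obtain v where v: "v \<in> V" "S \<in> spec_in P le (n, v)" using S unfolding O2_def by blast
      obtain u where u: "u \<in> U" "S \<in> spec_in P le (n, u)" using S unfolding O1_def by blast
      have "(u, v) \<in> E n" using u(2) v(2) spectrum_level_edge unfolding spec_in_def by blast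
      with no u(1) v(1) show False by blast
    qed
    then show ?thesis by blast
  qed
  moreover have "O1 \<inter> A \<noteq> {}" "O2 \<inter> A \<noteq> {}"
  proof -
    obtain u where "u \<in> U" using UV(1) by blast
    moreover from this have "u \<in> spec_trace G R A n" using UV(4) by blast
    ultimately show "O1 \<inter> A \<noteq> {}" by (auto simp: O1_def spec_trace_def)
    obtain v where "v \<in> V" using UV(2) by blast
    moreover from this have "v \<in> spec_trace G R A n" using UV(4) by blast
    ultimately show "O2 \<inter> A \<noteq> {}" by (auto simp: O2_def spec_trace_def)
  qed
  ultimately show False using connectedinD[OF con] by metis
qed

section \<open>Open covers and compactness\<close>

text \<open>Directedness of points makes the subbasis a basis: a common lower bound in
  \<open>S\<close> handles intersections.\<close>

lemma openin_contains_spec_in: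
  assumes "openin X U" "S \<in> U"
  shows "\<exists>p\<in>S. spec_in P le p \<subseteq> U"
proof -
  have "generate_topology_on (insert (spectrum P le) (spec_in P le ` P)) U"
    using assms(1) unfolding spectrum_topology_def openin_topology_generated_by_iff .
  moreover have "S \<in> spectrum P le" using openin_subset[OF assms(1)] assms(2) by auto
  ultimately show ?thesis using assms(2)
  proof (induction rule: generate_topology_on.induct)
    case (Int a b)
    then obtain p q where pq: "p \<in> S" "spec_in P le p \<subseteq> a" "q \<in> S" "spec_in P le q \<subseteq> b" by blast
    obtain w where "w \<in> S" "le w p" "le w q" using spectrum_directed[OF Int.prems(1) pq(1,3)] .
    with pq spec_in_mono show ?case by blast
  next
    case (UN K)
    then show ?case by blast
  next
    case (Basis s)
    show ?case
    proof (cases "s = spectrum P le")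
      case True
      \<comment> \<open>Only some element of \<open>S\<close> is needed here, and \<open>S\<close>
        is non-empty because it meets a cap.\<close>
      then show ?thesis
        using spectrum_meets_cap[OF Basis.prems(1) cap_level_band] unfolding spec_in_def by blast
    next
      case False
      then show ?thesis using Basis by (auto simp: spec_in_def)
    qed
  qed simp
qed

text \<open>The elements \<open>p\<close> with \<open>spec_in P le p\<close> inside a member of the
  cover meet every point, so they form a cap, which some level band refines.\<close>

lemma cover_refined_by_level_band:
  assumes "\<And>U. U \<in> \<U> \<Longrightarrow> openin X U" "spectrum P le \<subseteq> \<Union>\<U>"
  shows "\<exists>n. \<forall>b\<in>level_band n. \<exists>U\<in>\<U>. spec_in P le b \<subseteq> U"
proof -
  define C where "C = {p \<in> P. \<exists>U\<in>\<U>. spec_in P le p \<subseteq> U}"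
  have "cap P le C"
  proof (rule cap_if_meets_spectrum)
    fix S assume S: "S \<in> spectrum P le"
    then obtain U where "U \<in> \<U>" "S \<in> U" using assms(2) by blast
    then obtain p where "p \<in> S" "spec_in P le p \<subseteq> U" using openin_contains_spec_in assms(1) by blast
    then show "S \<inter> C \<noteq> {}"
      using spectrum_subset_carrier[OF S] \<open>U \<in> \<U>\<close> by (auto simp: C_def)
  qed (auto simp: C_def)
  then obtain N where N: "\<And>n b. N \<le> n \<Longrightarrow> b \<in> level_band n \<Longrightarrow> \<exists>c\<in>C. le b c"
    using level_band_refines_cap by blast
  have "\<exists>U\<in>\<U>. spec_in P le b \<subseteq> U" if b: "b \<in> level_band N" for b
  proof -
    obtain c where c: "c \<in> C" "le b c" using N[of N b] b by blast
    then obtain U where "U \<in> \<U>" "spec_in P le c \<subseteq> U" unfolding C_def by blast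
    with spec_in_mono[OF c(2)] show ?thesis by blast
  qed
  then show ?thesis by blast
qed

lemma compact_space_spectrum: "compact_space X"
  unfolding compact_space_alt
proof (intro allI impI, elim conjE)
  fix \<U> assume U: "\<forall>U\<in>\<U>. openin X U" "topspace X \<subseteq> \<Union>\<U>"
  then obtain n where n: "\<And>b. b \<in> level_band n \<Longrightarrow> \<exists>U\<in>\<U>. spec_in P le b \<subseteq> U"
    using cover_refined_by_level_band[of \<U>] unfolding topspace_spectrum_topology by blast
  then obtain f where f: "\<And>b. b \<in> level_band n \<Longrightarrow> f b \<in> \<U> \<and> spec_in P le b \<subseteq> f b" by metis
  have "topspace X \<subseteq> \<Union>(f ` level_band n)"
  proof
    fix S assume "S \<in> topspace X"
    then have S: "S \<in> spectrum P le" by simp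
    then obtain b where "b \<in> S" "b \<in> level_band n" using spectrum_meets_cap[OF S cap_level_band] by blast
    then show "S \<in> \<Union>(f ` level_band n)" using f[of b] S unfolding spec_in_def by blast
  qed
  moreover have "finite (f ` level_band n)" using band_level_band by (simp add: band_def)
  ultimately show "\<exists>\<F>. finite \<F> \<and> \<F> \<subseteq> \<U> \<and> topspace X \<subseteq> \<Union>\<F>" using f by blast
qed

section \<open>Co-bijective sequences and the converse\<close>

context
  assumes cobij: "co_bijective_sequence G R"
begin

text \<open>Co-bijectivity between consecutive levels puts an element strictly below every
  \<open>q\<close>, so there are no atoms.\<close>

lemma level_band_eq: "level_band n = {n} \<times> G n"
proof -
  have "\<not> atom q" for q
  proof
    assume q: "atom q"
    then have "snd q \<in> G (fst q)" by (auto simp: atom_def induced_carrier_def)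
    then obtain g where "rel_at (R (fst q) (Suc (fst q))) g = {snd q}"
      using cobij unfolding co_bijective_sequence_def co_bijective_def by (meson le_SucI order_refl)
    then have "le (Suc (fst q), g) q" by (auto simp: induced_le_def rel_at_def)
    then have "(Suc (fst q), g) = q" using q unfolding atom_def by blast
    then show False by (metis fst_conv n_not_Suc_n)
  qed
  then show ?thesis by (simp add: level_band_def)
qed

text \<open>Arbitrarily deep levels contain an element whose only upper bound on level
  \<open>n\<close> is \<open>p\<close>. Hence no deeper level refines
  \<open>level_band n - {p}\<close>, which is therefore not a cap.\<close>

lemma spec_in_nonempty:
  assumes "p \<in> P"
  shows "spec_in P le p \<noteq> {}"
proof -
  obtain n g where p: "p = (n, g)" and g: "g \<in> G n" using assms by (cases p) auto
  have "\<not> cap P le (level_band n - {p})"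
  proof
    assume "cap P le (level_band n - {p})"
    then obtain N where
      N: "\<And>m b. N \<le> m \<Longrightarrow> b \<in> level_band m \<Longrightarrow> \<exists>c\<in>level_band n - {p}. le b c"
      using level_band_refines_cap by blast
    \<comment> \<open>Level \<open>m\<close> must be at least \<open>n\<close> for co-bijectivity of
      \<open>R n m\<close>, and at least \<open>N\<close> to refine the supposed cap.\<close>
    define m where "m = max n N"
    obtain h where h: "h \<in> G m" "rel_at (R n m) h = {g}"
      using cobij g unfolding co_bijective_sequence_def co_bijective_def m_def
      by (meson max.cobounded1)
    then obtain c where "c \<in> level_band n - {p}" "le (m, h) c"
      using N[of m "(m, h)"] by (auto simp: level_band_eq m_def)
    then obtain g' where "g' \<noteq> g" "le (m, h) (n, g')" by (auto simp: level_band_eq p)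
    moreover from this have "g' \<in> rel_at (R n m) h" by (simp add: induced_le_def rel_at_def)
    ultimately show False using h(2) by simp
  qed
  then show ?thesis
    using spec_in_nonempty_if_not_cap[OF level_band_subset cap_level_band] by blast
qed

lemma trace_nonempty:
  assumes "A \<subseteq> spectrum P le" "A \<noteq> {}"
  shows "spec_trace G R A n \<noteq> {}"
proof -
  obtain S where SA: "S \<in> A" and S: "S \<in> spectrum P le" using assms by blast
  then obtain g where "g \<in> G n" "(n, g) \<in> S"
    using spectrum_meets_cap[OF S cap_level_band[of n]] by (auto simp: level_band_eq)
  then show ?thesis using SA S by (auto simp: spec_trace_def spec_in_def)
qed

lemma connected_if_trace_neighbourhood_connected:
  assumes faithful: "edge_faithful G E R" and Haus: "Hausdorff_space X"
    and A: "closedin X A"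
    and con: "\<And>n. graph_connected (E n) (neighbourhood (G n) (E n) (spec_trace G R A n))"
  shows "connectedin X A"
proof (rule ccontr)
  assume "\<not> connectedin X A"
  then obtain K L where KL: "closedin X K" "closedin X L" "A \<subseteq> K \<union> L" "K \<inter> L \<inter> A = {}"
      "K \<inter> A \<noteq> {}" "L \<inter> A \<noteq> {}"
    unfolding connectedin_closedin using closedin_subset[OF A] by blast
  \<comment> \<open>As \<open>A\<close> is closed, both halves are closed in the whole spectrum, so
    Urysohn's lemma applies to them.\<close>
  define B C where "B = A \<inter> K" and "C = A \<inter> L"
  have BC: "closedin X B" "closedin X C" "disjnt B C" "B \<noteq> {}" "C \<noteq> {}" "B \<union> C = A"
    using KL A by (auto simp: B_def C_def disjnt_def)
  then have BCs: "B \<subseteq> spectrum P le" "C \<subseteq> spectrum P le" using closedin_subset by fastforce+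
  have "normal_space X"
    using compact_Hausdorff_or_regular_imp_normal_space compact_space_spectrum Haus by blast
  then obtain f where f: "continuous_map X (top_of_set {0..1::real}) f" "f ` B \<subseteq> {0}" "f ` C \<subseteq> {1}"
    using Urysohn_lemma[of X B C 0 1] BC(1-3) by auto
  have cont: "continuous_map X euclideanreal f" using f(1) by (simp add: continuous_map_in_subtopology)
  \<comment> \<open>With radius 1/8, values of \<open>f\<close> at two points of the same
    \<open>W S\<close> differ by less than 1/4.\<close>
  define W where "W S = {T \<in> topspace X. f T \<in> ball (f S) (1/8)}" for S
  have "\<exists>n. \<forall>b\<in>level_band n. \<exists>U\<in>range W. spec_in P le b \<subseteq> U"
  proof (rule cover_refined_by_level_band[of "range W"])
    have "openin X (W S)" for S
      unfolding W_def by (rule openin_continuous_map_preimage[OF cont]) simp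
    then show "openin X U" if "U \<in> range W" for U
      using that by blast
  next
    have "S \<in> W S" if "S \<in> spectrum P le" for S using that by (simp add: W_def)
    then show "spectrum P le \<subseteq> \<Union>(range W)" by blast
  qed
  then obtain n where n: "\<And>b. b \<in> level_band n \<Longrightarrow> \<exists>U\<in>range W. spec_in P le b \<subseteq> U" by blast
  have small: "\<bar>f S - f T\<bar> < 1/4"
    if "S \<in> spectrum P le" "T \<in> spectrum P le" "(n, g) \<in> S" "(n, g) \<in> T" for S T g
  proof -
    have "(n, g) \<in> level_band n" using that spectrum_subset_carrier by (fastforce simp: level_band_eq)
    then obtain Q where Q: "spec_in P le (n, g) \<subseteq> W Q" using n by blast
    then have "S \<in> W Q" "T \<in> W Q" using that by (auto simp: spec_in_def)
    then have "\<bar>f Q - f S\<bar> < 1/8" "\<bar>f Q - f T\<bar> < 1/8" by (auto simp: W_def dist_real_def)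
    then show ?thesis by linarith
  qed
  \<comment> \<open>Edge-faithfulness turns the edge into a common lower bound \<open>r\<close>,
    co-bijectivity gives a point through \<open>r\<close>, and up-closure does the rest.\<close>
  have meet: "\<exists>S\<in>spectrum P le. (n, g) \<in> S \<and> (n, h) \<in> S"
    if gh: "g \<in> G n" "h \<in> G n" "(g, h) \<in> E n" for g h
  proof -
    obtain r where r: "r \<in> P" "le r (n, g)" "le r (n, h)"
      using faithful gh unfolding edge_faithful_def by blast
    obtain S where "S \<in> spec_in P le r" using spec_in_nonempty[OF r(1)] by blast
    then have S: "S \<in> spectrum P le" "r \<in> S" by (simp_all add: spec_in_def)
    with up_closed[OF S r(2)] up_closed[OF S r(3)] show ?thesis by blast
  qed
  define U V where "U = neighbourhood (G n) (E n) (spec_trace G R B n)"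
    and "V = neighbourhood (G n) (E n) (spec_trace G R C n)"
  \<comment> \<open>The consecutive points \<open>S0\<close>, ..., \<open>S4\<close> share
    \<open>b\<close>, \<open>u\<close>, \<open>v\<close> and \<open>c\<close> in turn. Four changes
    of \<open>f\<close> by less than 1/4 cannot lead from 0 on \<open>B\<close> to 1 on
    \<open>C\<close>.\<close>
  have no: "(u, v) \<notin> E n" if u: "u \<in> U" and v: "v \<in> V" for u v
  proof
    assume uv: "(u, v) \<in> E n"
    obtain b where b: "u \<in> G n" "b \<in> spec_trace G R B n" "(b, u) \<in> E n"
      using u by (auto simp: U_def neighbourhood_def)
    obtain c where c: "v \<in> G n" "c \<in> spec_trace G R C n" "(c, v) \<in> E n"
      using v by (auto simp: V_def neighbourhood_def)
    obtain S0 where S0: "S0 \<in> B" "(n, b) \<in> S0" "b \<in> G n"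
      using b(2) by (auto simp: spec_trace_def spec_in_def)
    obtain S4 where S4: "S4 \<in> C" "(n, c) \<in> S4" "c \<in> G n"
      using c(2) by (auto simp: spec_trace_def spec_in_def)
    obtain S1 where S1: "S1 \<in> spectrum P le" "(n, b) \<in> S1" "(n, u) \<in> S1"
      using meet[OF S0(3) b(1,3)] by blast
    obtain S2 where S2: "S2 \<in> spectrum P le" "(n, u) \<in> S2" "(n, v) \<in> S2"
      using meet[OF b(1) c(1) uv] by blast
    obtain S3 where S3: "S3 \<in> spectrum P le" "(n, c) \<in> S3" "(n, v) \<in> S3"
      using meet[OF S4(3) c(1,3)] by blast
    have "\<bar>f S0 - f S1\<bar> < 1/4" using small[of S0 S1 b] S0 S1 BCs by blast
    moreover have "\<bar>f S1 - f S2\<bar> < 1/4" using small[of S1 S2 u] S1 S2 by blast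
    moreover have "\<bar>f S2 - f S3\<bar> < 1/4" using small[of S2 S3 v] S2 S3 by blast
    moreover have "\<bar>f S3 - f S4\<bar> < 1/4" using small[of S3 S4 c] S3 S4 BCs by blast
    moreover have "f S0 = 0" "f S4 = 1" using f(2,3) S0(1) S4(1) by auto
    ultimately show False by linarith
  qed
  have sub: "spec_trace G R D n \<subseteq> neighbourhood (G n) (E n) (spec_trace G R D n)" for D
    using edge_refl by (auto simp: neighbourhood_def spec_trace_def)
  have "U \<noteq> {}" "V \<noteq> {}"
    using sub trace_nonempty BC(4,5) BCs unfolding U_def V_def by blast+
  \<comment> \<open>The loop at a common vertex would be an edge between \<open>U\<close> and
    \<open>V\<close>.\<close>
  moreover have "U \<inter> V = {}"
    using no edge_refl by (fastforce simp: U_def neighbourhood_def)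
  moreover have "U \<union> V = neighbourhood (G n) (E n) (spec_trace G R A n)"
    unfolding U_def V_def BC(6)[symmetric] neighbourhood_def spec_trace_def by blast
  ultimately show False using graph_connectedD[OF con] no by metis
qed

end

end

theorem proposition4p25:
  fixes G :: "nat \<Rightarrow> 'a set" and E :: "nat \<Rightarrow> 'a rel" and R :: "nat \<Rightarrow> nat \<Rightarrow> 'a rel"
    and A :: "(nat \<times> 'a) set set"
  defines "X \<equiv> spectrum_topology (induced_carrier G) (induced_le R)"
  assumes "S_sequence G E R"
    and "A \<subseteq> spectrum (induced_carrier G) (induced_le R)"
  shows "(connectedin X A \<longrightarrow> (\<forall>n. graph_connected (E n) (spec_trace G R A n))) \<and>
    ((\<forall>n. graph_connected (E n) (spec_trace G R A n)) \<longrightarrow>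
      (\<forall>n. graph_connected (E n) (neighbourhood (G n) (E n) (spec_trace G R A n)))) \<and>
    (co_bijective_sequence G R \<and> edge_faithful G E R \<and> Hausdorff_space X \<and> closedin X A \<longrightarrow>
      (connectedin X A \<longleftrightarrow> (\<forall>n. graph_connected (E n) (spec_trace G R A n))) \<and>
      ((\<forall>n. graph_connected (E n) (spec_trace G R A n)) \<longleftrightarrow>
        (\<forall>n. graph_connected (E n) (neighbourhood (G n) (E n) (spec_trace G R A n)))))"
proof -
  interpret graph_sequence G E R using assms(2) by unfold_locales
  have 12: "connectedin X A \<Longrightarrow> graph_connected (E n) (spec_trace G R A n)" for n
    using connected_trace assms(3) unfolding X_def .
  have 23: "graph_connected (E n) (spec_trace G R A n) \<Longrightarrow>
      graph_connected (E n) (neighbourhood (G n) (E n) (spec_trace G R A n))" for n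
    by (rule graph_connected_neighbourhood[OF graph]) (auto simp: spec_trace_def)
  have 31: "connectedin X A"
    if "co_bijective_sequence G R" "edge_faithful G E R" "Hausdorff_space X" "closedin X A"
      "\<forall>n. graph_connected (E n) (neighbourhood (G n) (E n) (spec_trace G R A n))"
    using connected_if_trace_neighbourhood_connected that unfolding X_def by blast
  show ?thesis using 12 23 31 by blast
qed

end
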